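(* Let $A$ be an Artinian skew left brace of finite weight. If $A$ is perfect, then $\omega(A)=1$.
   Context: A skew left brace is a triple $(A,+,\circ)$ where $(A,+)$ and $(A,\circ)$ are (not necessarily abelian) groups with $a\circ(b+c)=a\circ b-a+a\circ c$ for all $a,b,c\in A$. Put $\lambda_a(b)=-a+a\circ b$ and $a*b=\lambda_a(b)-b=-a+a\circ b-b$. An ideal of $A$ is a subgroup $I$ of $(A,+)$ that is normal in $(A,+)$, satisfies $\lambda_a(I)\subseteq I$ for all $a\in A$, and is a normal subgroup of $(A,\circ)$. A subset $S\subseteq A$ generates $A$ (as an ideal) if the smallest ideal of $A$ containing $S$ is $A$. The weight $\omega(A)$ of a non-zero skew left brace $A$ is the minimal number of elements of $A$ needed to generate $A$ as an ideal; by convention $\omega(0)=1$. $A$ has finite weight if it is generated as an ideal by a finite subset. $A$ is Artinian if every descending chain of ideals of $A$ is eventually stationary. $A^{(2)}$ is the additive subgroup generated by all $a*b$ with $a,b\in A$, and $A$ is perfect if $A=A^{(2)}$. *)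

theory Defs
  imports "HOL-Algebra.Generated_Groups" "HOL-Algebra.Ring" "HOL-Library.Extended_Nat"
begin

text \<open>
  A skew left brace is carried by the record type of rings: \<open>\<oplus>\<close> is the (not necessarily
  commutative) brace addition and \<open>\<otimes>\<close> is the circle operation. Only the two group structures
  and the brace identity are assumed, none of the ring axioms; \<open>\<ominus>\<close> denotes the inverse in the
  group \<open>add_monoid A\<close>, and \<open>x \<ominus> y\<close> is \<open>x \<oplus> (\<ominus> y)\<close>.
\<close>

locale skew_left_brace =
  fixes A (structure)
  assumes add_group: "group (add_monoid A)"
    and circ_group: "group A"
    and brace_distrib:
      "\<lbrakk>a \<in> carrier A; b \<in> carrier A; c \<in> carrier A\<rbrakk>
        \<Longrightarrow> a \<otimes> (b \<oplus> c) = (a \<otimes> b \<ominus> a) \<oplus> a \<otimes> c"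

definition brace_lambda :: "('a, 'b) ring_scheme \<Rightarrow> 'a \<Rightarrow> 'a \<Rightarrow> 'a" where
  "brace_lambda A a b = (\<ominus>\<^bsub>A\<^esub> a) \<oplus>\<^bsub>A\<^esub> (a \<otimes>\<^bsub>A\<^esub> b)"

definition brace_star :: "('a, 'b) ring_scheme \<Rightarrow> 'a \<Rightarrow> 'a \<Rightarrow> 'a" where
  "brace_star A a b = brace_lambda A a b \<ominus>\<^bsub>A\<^esub> b"

definition brace_ideal :: "'a set \<Rightarrow> ('a, 'b) ring_scheme \<Rightarrow> bool" where
  "brace_ideal I A \<longleftrightarrow>
     I \<lhd> add_monoid A \<and> (\<forall>a\<in>carrier A. brace_lambda A a ` I \<subseteq> I) \<and> I \<lhd> A"

definition generated_ideal :: "('a, 'b) ring_scheme \<Rightarrow> 'a set \<Rightarrow> 'a set" where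
  "generated_ideal A S = \<Inter>{I. brace_ideal I A \<and> S \<subseteq> I}"

definition generates_as_ideal :: "'a set \<Rightarrow> ('a, 'b) ring_scheme \<Rightarrow> bool" where
  "generates_as_ideal S A \<longleftrightarrow> S \<subseteq> carrier A \<and> generated_ideal A S = carrier A"

definition finite_weight :: "('a, 'b) ring_scheme \<Rightarrow> bool" where
  "finite_weight A \<longleftrightarrow> (\<exists>S. finite S \<and> generates_as_ideal S A)"

text \<open>
  The weight is valued in \<^typ>\<open>enat\<close>: it is \<open>\<infinity>\<close> when no finite set generates the brace.
  The zero brace, which is generated by the empty set, has weight 1 by convention.
\<close>

definition weight :: "('a, 'b) ring_scheme \<Rightarrow> enat" where
  "weight A = (if carrier A = {\<zero>\<^bsub>A\<^esub>} then 1
     else (INF S\<in>{S. finite S \<and> generates_as_ideal S A}. enat (card S)))"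

definition artinian_brace :: "('a, 'b) ring_scheme \<Rightarrow> bool" where
  "artinian_brace A \<longleftrightarrow>
     (\<forall>I :: nat \<Rightarrow> 'a set. (\<forall>n. brace_ideal (I n) A) \<and> (\<forall>n. I (Suc n) \<subseteq> I n)
        \<longrightarrow> (\<exists>N. \<forall>n\<ge>N. I n = I N))"

definition brace_square :: "('a, 'b) ring_scheme \<Rightarrow> 'a set" where
  "brace_square A =
     generate (add_monoid A) {brace_star A a b | a b. a \<in> carrier A \<and> b \<in> carrier A}"

definition perfect_brace :: "('a, 'b) ring_scheme \<Rightarrow> bool" where
  "perfect_brace A \<longleftrightarrow> carrier A = brace_square A"

end

theory Submission
  imports Defs "HOL-Algebra.Zassenhaus"
begin

text \<open>
  In a perfect brace every maximal ideal \<open>M\<close> is prime for intersections: if \<open>I\<close> and \<open>K\<close> are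
  ideals not contained in \<open>M\<close>, then \<open>M + I = A = M + K\<close>, so every \<open>a * b\<close> is congruent modulo
  \<open>M\<close> to some \<open>i * k \<in> I \<inter> K\<close>; hence \<open>I \<inter> K \<subseteq> M\<close> would force \<open>A\<^sup>(\<^sup>2\<^sup>) \<subseteq> M\<close>. By the descending
  chain condition applied to the partial intersections of a sequence of maximal ideals, there
  are only finitely many of them, and primality then yields an element outside all of them.
  Finite weight puts every proper ideal inside a maximal one, so this element generates.
\<close>

section \<open>Products and chain unions of normal subgroups\<close>

lemma (in group) normal_set_mult:
  assumes "N \<lhd> G" "M \<lhd> G"
  shows "N <#> M \<lhd> G"
proof (rule normal_invI)
  interpret N: normal N G by fact
  interpret M: normal M G by fact
  show "subgroup (N <#> M) G"
    using assms by (intro mult_norm_subgroup) (auto intro: normal_imp_subgroup)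
  fix x h assume x: "x \<in> carrier G" and "h \<in> N <#> M"
  then obtain n m where h: "h = n \<otimes> m" and n: "n \<in> N" and m: "m \<in> M"
    by (auto simp: set_mult_def)
  have nc: "n \<in> carrier G" and mc: "m \<in> carrier G" using n m by auto
  \<comment> \<open>This cancels the inner \<open>inv x \<otimes> x\<close> in the product of the
    two conjugates of \<open>n\<close> and \<open>m\<close>.\<close>
  have "inv x \<otimes> (x \<otimes> y) = y" if "y \<in> carrier G" for y
    using x that by (simp add: m_assoc[symmetric])
  then have "x \<otimes> h \<otimes> inv x = (x \<otimes> n \<otimes> inv x) \<otimes> (x \<otimes> m \<otimes> inv x)"
    using x nc mc by (simp add: h m_assoc)
  moreover have "x \<otimes> n \<otimes> inv x \<in> N" "x \<otimes> m \<otimes> inv x \<in> M"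
    using x n m by (auto intro: N.inv_op_closed2 M.inv_op_closed2)
  ultimately show "x \<otimes> h \<otimes> inv x \<in> N <#> M"
    by (auto simp: set_mult_def)
qed

lemma (in group) normal_chain_Union:
  assumes "\<C> \<noteq> {}" "subset.chain {N. N \<lhd> G} \<C>"
  shows "\<Union>\<C> \<lhd> G"
proof (rule normal_invI)
  have nrm: "\<And>N. N \<in> \<C> \<Longrightarrow> N \<lhd> G" and sub: "\<And>N. N \<in> \<C> \<Longrightarrow> subgroup N G"
    using assms(2) by (auto simp: subset_chain_def intro: normal_imp_subgroup)
  show "subgroup (\<Union>\<C>) G"
  proof
    show "\<Union>\<C> \<subseteq> carrier G" using subgroup.subset[OF sub] by blast
    show "\<one> \<in> \<Union>\<C>" using assms(1) subgroup.one_closed[OF sub] by blast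
    show "inv x \<in> \<Union>\<C>" if "x \<in> \<Union>\<C>" for x
      using that subgroup.m_inv_closed[OF sub] by blast
    fix x y assume "x \<in> \<Union>\<C>" "y \<in> \<Union>\<C>"
    then obtain X Y where "X \<in> \<C>" "Y \<in> \<C>" "x \<in> X" "y \<in> Y" by auto
    \<comment> \<open>Chain members are comparable, so the larger of \<open>X\<close> and
      \<open>Y\<close> serves as \<open>Z\<close>.\<close>
    then obtain Z where "Z \<in> \<C>" "x \<in> Z" "y \<in> Z"
      using assms(2) unfolding subset_chain_def by (metis subset_iff)
    then show "x \<otimes> y \<in> \<Union>\<C>" using subgroup.m_closed[OF sub] by blast
  qed
  show "x \<otimes> h \<otimes> inv x \<in> \<Union>\<C>" if "x \<in> carrier G" "h \<in> \<Union>\<C>" for x h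
    using that normal.inv_op_closed2[OF nrm] by blast
qed

section \<open>The two groups of a brace and the lambda action\<close>

sublocale skew_left_brace \<subseteq> circ: group A
  by (rule circ_group)

sublocale skew_left_brace \<subseteq> add: group "add_monoid A"
  rewrites "carrier (add_monoid A) = carrier A"
    and "mult (add_monoid A) = add A"
    and "one (add_monoid A) = zero A"
    and "m_inv (add_monoid A) = a_inv A"
  by (rule add_group) (auto simp: m_inv_def a_inv_def)

lemma brace_ideal_carrier_subset: "brace_ideal I A \<Longrightarrow> I \<subseteq> carrier A"
  by (meson brace_ideal_def normal_imp_subgroup subgroup.subset)

context skew_left_brace
begin

abbreviation lam where "lam \<equiv> brace_lambda A"

lemma lam_closed [simp]: "\<lbrakk>a \<in> carrier A; b \<in> carrier A\<rbrakk> \<Longrightarrow> lam a b \<in> carrier A"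
  by (simp add: brace_lambda_def)

lemma circ_eq_add_lam: "\<lbrakk>a \<in> carrier A; b \<in> carrier A\<rbrakk> \<Longrightarrow> a \<otimes> b = a \<oplus> lam a b"
  by (simp add: brace_lambda_def add.m_assoc[symmetric])

text \<open>This is the brace identity with \<ominus> a added on the left.\<close>

lemma lam_add:
  assumes "a \<in> carrier A" "b \<in> carrier A" "c \<in> carrier A"
  shows "lam a (b \<oplus> c) = lam a b \<oplus> lam a c"
  using assms by (simp add: brace_lambda_def brace_distrib a_minus_def add.m_assoc)

lemma circ_zero: "a \<in> carrier A \<Longrightarrow> a \<otimes> \<zero> = a"
proof -
  assume a: "a \<in> carrier A"
  \<comment> \<open>By additivity, and an idempotent of a group is its neutral element.\<close>
  have "lam a \<zero> \<oplus> lam a \<zero> = lam a \<zero>"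
    using lam_add[OF a, of \<zero> \<zero>] by simp
  then have "lam a \<zero> = \<zero>" using a by simp
  then show ?thesis using a by (simp add: circ_eq_add_lam)
qed

lemma one_eq_zero: "\<one> = \<zero>"
  using circ_zero[of \<one>] by simp

lemma lam_zero: "a \<in> carrier A \<Longrightarrow> lam a \<zero> = \<zero>"
  by (simp add: brace_lambda_def circ_zero)

lemma lam_zero_left: "b \<in> carrier A \<Longrightarrow> lam \<zero> b = b"
  \<comment> \<open>Reading the zero as \<one> makes the circle unit law apply; the second call goes
    back to \<zero> for the additive one.\<close>
  by (simp add: brace_lambda_def one_eq_zero[symmetric]) (simp add: one_eq_zero)

lemma lam_neg:
  assumes "a \<in> carrier A" "b \<in> carrier A"
  shows "lam a (\<ominus> b) = \<ominus> lam a b"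
  using lam_add[of a "\<ominus> b" b] assms by (simp add: lam_zero add.inv_equality)

text \<open>Together with \<open>lam_add\<close> and \<open>lam_zero_left\<close>, this makes lambda
  an action of the circle group by automorphisms of the additive group.\<close>

lemma lam_circ:
  assumes "a \<in> carrier A" "b \<in> carrier A" "c \<in> carrier A"
  shows "lam (a \<otimes> b) c = lam a (lam b c)"
proof -
  have "lam a (lam b c) = lam a (\<ominus> b) \<oplus> lam a (b \<otimes> c)"
    using assms by (subst (2) brace_lambda_def) (simp add: lam_add)
  also have "\<dots> = \<ominus> (a \<otimes> b) \<oplus> a \<oplus> lam a (b \<otimes> c)"
    using assms by (simp add: lam_neg) (simp add: brace_lambda_def add.inv_mult_group)
  also have "\<dots> = lam (a \<otimes> b) c"
    using assms by (simp add: add.m_assoc circ_eq_add_lam[symmetric])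
      (simp add: brace_lambda_def circ.m_assoc)
  finally show ?thesis by simp
qed

text \<open>Converse of \<open>circ_eq_add_lam\<close>: by the action law,
  \<open>lam (inv a)\<close> inverts \<open>lam a\<close>.\<close>

lemma add_eq_circ_lam:
  assumes "a \<in> carrier A" "b \<in> carrier A"
  shows "a \<oplus> b = a \<otimes> lam (inv a) b"
  using assms circ_eq_add_lam[of a "lam (inv a) b"] lam_circ[of a "inv a" b]
  by (simp add: one_eq_zero lam_zero_left)

section \<open>Ideals, their cosets and sums\<close>

lemma brace_idealD:
  assumes "brace_ideal I A"
  shows "normal I (add_monoid A)" "normal I A"
    and "\<lbrakk>a \<in> carrier A; x \<in> I\<rbrakk> \<Longrightarrow> lam a x \<in> I"
  using assms by (auto simp: brace_ideal_def)

lemma zero_mem_ideal: "brace_ideal I A \<Longrightarrow> \<zero> \<in> I"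
  by (metis brace_idealD(2) normal_imp_subgroup one_eq_zero subgroup.one_closed)

lemma add_mem_ideal: "\<lbrakk>brace_ideal I A; x \<in> I; y \<in> I\<rbrakk> \<Longrightarrow> x \<oplus> y \<in> I"
  using subgroup.m_closed[OF normal_imp_subgroup[OF brace_idealD(1)]] by simp

lemma neg_mem_ideal: "\<lbrakk>brace_ideal I A; x \<in> I\<rbrakk> \<Longrightarrow> \<ominus> x \<in> I"
  using subgroup.m_inv_closed[OF normal_imp_subgroup[OF brace_idealD(1)]]
  by (simp add: a_inv_def)

lemma add_mem_ideal_iff:
  assumes "brace_ideal I A" "y \<in> I" "x \<in> carrier A"
  shows "x \<oplus> y \<in> I \<longleftrightarrow> x \<in> I"
proof
  have y: "y \<in> carrier A" using assms brace_ideal_carrier_subset by blast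
  assume "x \<oplus> y \<in> I"
  then have "(x \<oplus> y) \<oplus> \<ominus> y \<in> I" using assms by (blast intro: add_mem_ideal neg_mem_ideal)
  then show "x \<in> I" using assms y by (simp add: add.m_assoc)
qed (use assms add_mem_ideal in blast)

lemma brace_ideal_carrier: "brace_ideal (carrier A) A"
  using add.normal_invI[of "carrier A"] circ.normal_invI[of "carrier A"]
    add.subgroup_self circ.subgroup_self
  by (auto simp: brace_ideal_def)

lemma brace_ideal_zero: "brace_ideal {\<zero>} A"
  using add.one_is_normal circ.one_is_normal
  by (auto simp: brace_ideal_def lam_zero one_eq_zero)

lemma brace_ideal_Int: "\<lbrakk>brace_ideal I A; brace_ideal K A\<rbrakk> \<Longrightarrow> brace_ideal (I \<inter> K) A"
  unfolding brace_ideal_def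
  by (intro conjI add.normal_subgroup_intersect circ.normal_subgroup_intersect) blast+

text \<open>Left cosets agree because \<open>lam x\<close> and \<open>lam (inv x)\<close> preserve
  \<open>I\<close> and convert between x \<oplus> i and x \<otimes> i; normality in both groups
  carries this over to right cosets. Hence a single quotient set carries both operations.\<close>

lemma add_coset_eq_circ_coset:
  assumes "brace_ideal I A" "x \<in> carrier A"
  shows "I #>\<^bsub>add_monoid A\<^esub> x = I #> x"
proof -
  note I = brace_idealD[OF assms(1)]
  have sub: "I \<subseteq> carrier A" using assms(1) by (rule brace_ideal_carrier_subset)
  have "x <#\<^bsub>add_monoid A\<^esub> I = x <# I"
  proof
    show "x <#\<^bsub>add_monoid A\<^esub> I \<subseteq> x <# I"
      using assms(2) sub I(3)[of "inv x"] by (fastforce simp: l_coset_def add_eq_circ_lam)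
    show "x <# I \<subseteq> x <#\<^bsub>add_monoid A\<^esub> I"
      using assms(2) sub I(3)[of x] by (fastforce simp: l_coset_def circ_eq_add_lam)
  qed
  then show ?thesis
    using assms(2) normal.coset_eq[OF I(1)] normal.coset_eq[OF I(2)] by simp
qed

text \<open>The additive sum is a union of cosets of \<open>I\<close>, so it equals the circle
  product. Normality in each group then comes from \<open>normal_set_mult\<close>, and
  lambda-invariance from additivity.\<close>

lemma brace_ideal_sum:
  assumes "brace_ideal I A" "brace_ideal K A"
  shows "brace_ideal (I <#>\<^bsub>add_monoid A\<^esub> K) A"
proof -
  note I = brace_idealD[OF assms(1)] and K = brace_idealD[OF assms(2)]
  have sub: "I \<subseteq> carrier A" "K \<subseteq> carrier A"
    using assms by (auto dest: brace_ideal_carrier_subset)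
  have "I <#>\<^bsub>add_monoid A\<^esub> K = (\<Union>k\<in>K. I #>\<^bsub>add_monoid A\<^esub> k)"
    by (auto simp: set_mult_def r_coset_def)
  also have "\<dots> = (\<Union>k\<in>K. I #> k)"
    using add_coset_eq_circ_coset[OF assms(1)] sub by auto
  also have "\<dots> = I <#> K"
    by (auto simp: set_mult_def r_coset_def)
  finally have eq: "I <#>\<^bsub>add_monoid A\<^esub> K = I <#> K" .
  have "lam a x \<in> I <#>\<^bsub>add_monoid A\<^esub> K"
    if a: "a \<in> carrier A" and x: "x \<in> I <#>\<^bsub>add_monoid A\<^esub> K" for a x
  proof -
    obtain i k where ik: "i \<in> I" "k \<in> K" "x = i \<oplus> k" using x by (auto simp: set_mult_def)
    then have "lam a x = lam a i \<oplus> lam a k" using a sub by (auto intro: lam_add)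
    then show ?thesis using ik I(3)[OF a] K(3)[OF a] by (auto simp: set_mult_def)
  qed
  then show ?thesis
    using add.normal_set_mult[OF I(1) K(1)] circ.normal_set_mult[OF I(2) K(2)] eq
    by (auto simp: brace_ideal_def)
qed

section \<open>The star operation modulo an ideal\<close>

lemma brace_star_closed [simp]:
  "\<lbrakk>a \<in> carrier A; b \<in> carrier A\<rbrakk> \<Longrightarrow> brace_star A a b \<in> carrier A"
  by (simp add: brace_star_def a_minus_def)

lemma brace_star_zero: "a \<in> carrier A \<Longrightarrow> brace_star A a \<zero> = \<zero>"
  by (simp add: brace_star_def a_minus_def lam_zero)

lemma brace_star_zero_left: "b \<in> carrier A \<Longrightarrow> brace_star A \<zero> b = \<zero>"
  by (simp add: brace_star_def a_minus_def lam_zero_left)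

text \<open>The coset map respects addition, negation and, since the two kinds of coset coincide,
  the circle operation; so star descends to the quotient.\<close>

lemma brace_star_cong_ideal:
  assumes I: "brace_ideal I A"
    and cl: "a \<in> carrier A" "a' \<in> carrier A" "b \<in> carrier A" "b' \<in> carrier A"
    and a: "I #>\<^bsub>add_monoid A\<^esub> a = I #>\<^bsub>add_monoid A\<^esub> a'"
    and b: "I #>\<^bsub>add_monoid A\<^esub> b = I #>\<^bsub>add_monoid A\<^esub> b'"
  shows "I #>\<^bsub>add_monoid A\<^esub> brace_star A a b = I #>\<^bsub>add_monoid A\<^esub> brace_star A a' b'"
proof -
  let ?q = "\<lambda>x. I #>\<^bsub>add_monoid A\<^esub> x"
  interpret N: normal I "add_monoid A" by (rule brace_idealD(1)[OF I])
  interpret C: normal I A by (rule brace_idealD(2)[OF I])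
  have plus: "?q (x \<oplus> y) = ?q x <#>\<^bsub>add_monoid A\<^esub> ?q y"
    if "x \<in> carrier A" "y \<in> carrier A" for x y
    using N.rcos_sum[of x y] that by simp
  have neg: "?q (\<ominus> x) = set_inv\<^bsub>add_monoid A\<^esub> ?q x" if "x \<in> carrier A" for x
    using N.rcos_inv[of x] that by (simp add: a_inv_def)
  have circ: "?q (x \<otimes> y) = ?q x <#> ?q y" if "x \<in> carrier A" "y \<in> carrier A" for x y
    using C.rcos_sum[of x y] that add_coset_eq_circ_coset[OF I] by simp
  show ?thesis
    using cl a b by (simp add: brace_star_def brace_lambda_def a_minus_def plus neg circ)
qed

lemma coset_eq_zero_coset_iff:
  assumes "brace_ideal I A" "x \<in> carrier A"
  shows "I #>\<^bsub>add_monoid A\<^esub> x = I #>\<^bsub>add_monoid A\<^esub> \<zero> \<longleftrightarrow> x \<in> I"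
  using assms add.coset_join1[of I x] add.coset_join2[of x I] add.coset_mult_one[of I]
    brace_ideal_carrier_subset[OF assms(1)] normal_imp_subgroup[OF brace_idealD(1)[OF assms(1)]]
  by auto

text \<open>Modulo \<open>I\<close> the left factor becomes zero, modulo \<open>K\<close> the right
  one, and star vanishes when either argument is zero.\<close>

lemma brace_star_mem_Int:
  assumes "brace_ideal I A" "brace_ideal K A" "i \<in> I" "k \<in> K"
  shows "brace_star A i k \<in> I \<inter> K"
proof -
  have c: "i \<in> carrier A" "k \<in> carrier A" using assms brace_ideal_carrier_subset by blast+
  have "brace_star A i k \<in> I"
    using brace_star_cong_ideal[OF assms(1), of i \<zero> k k] coset_eq_zero_coset_iff[OF assms(1)]
      c assms(3) by (metis add.one_closed brace_star_closed brace_star_zero_left)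
  moreover have "brace_star A i k \<in> K"
    using brace_star_cong_ideal[OF assms(2), of i i k \<zero>] coset_eq_zero_coset_iff[OF assms(2)]
      c assms(4) by (metis add.one_closed brace_star_closed brace_star_zero)
  ultimately show ?thesis by simp
qed

section \<open>Maximal ideals: primality, finiteness, avoidance, existence\<close>

definition maximal_ideal :: "'a set \<Rightarrow> bool" where
  "maximal_ideal M \<longleftrightarrow> brace_ideal M A \<and> M \<noteq> carrier A \<and>
     (\<forall>I. brace_ideal I A \<longrightarrow> M \<subseteq> I \<longrightarrow> I = M \<or> I = carrier A)"

text \<open>The sum of \<open>M\<close> and \<open>I\<close> is an ideal strictly above
  \<open>M\<close>, hence everything; so every coset of \<open>M\<close> has a representative in
  \<open>I\<close>.\<close>

lemma maximal_ideal_sum: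
  assumes "maximal_ideal M" "brace_ideal I A" "\<not> I \<subseteq> M" "a \<in> carrier A"
  obtains i where "i \<in> I" "M #>\<^bsub>add_monoid A\<^esub> a = M #>\<^bsub>add_monoid A\<^esub> i"
proof -
  have M: "brace_ideal M A" using assms(1) by (simp add: maximal_ideal_def)
  have sub: "M \<subseteq> carrier A" "I \<subseteq> carrier A"
    using M assms(2) by (auto dest: brace_ideal_carrier_subset)
  let ?S = "M <#>\<^bsub>add_monoid A\<^esub> I"
  have "M \<subseteq> ?S"
  proof
    fix m assume "m \<in> M"
    then show "m \<in> ?S"
      using sub zero_mem_ideal[OF assms(2)] by (force simp: set_mult_def)
  qed
  moreover have "I \<subseteq> ?S"
  proof
    fix i assume "i \<in> I"
    then show "i \<in> ?S"
      using sub zero_mem_ideal[OF M] by (force simp: set_mult_def)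
  qed
  ultimately have "?S = carrier A"
    using assms(1,3) brace_ideal_sum[OF M assms(2)] unfolding maximal_ideal_def by blast
  then have "a \<in> ?S" using assms(4) by blast
  then obtain m i where mi: "m \<in> M" "i \<in> I" "a = m \<oplus> i"
    by (auto simp: set_mult_def)
  have "a \<in> M #>\<^bsub>add_monoid A\<^esub> i" using mi by (auto simp: r_coset_def)
  then have "M #>\<^bsub>add_monoid A\<^esub> i = M #>\<^bsub>add_monoid A\<^esub> a"
    using add.repr_independence[of a M i] mi sub normal_imp_subgroup[OF brace_idealD(1)[OF M]]
    by auto
  then show ?thesis using that mi by simp
qed

lemma maximal_ideal_prime:
  assumes "perfect_brace A" "maximal_ideal M" "brace_ideal I A" "brace_ideal K A"
    and "I \<inter> K \<subseteq> M"
  shows "I \<subseteq> M \<or> K \<subseteq> M"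
proof (rule ccontr)
  assume "\<not> ?thesis"
  then have nI: "\<not> I \<subseteq> M" and nK: "\<not> K \<subseteq> M" by auto
  have M: "brace_ideal M A" using assms(2) by (simp add: maximal_ideal_def)
  have "brace_star A a b \<in> M" if ab: "a \<in> carrier A" "b \<in> carrier A" for a b
  proof -
    obtain i where i: "i \<in> I" "M #>\<^bsub>add_monoid A\<^esub> a = M #>\<^bsub>add_monoid A\<^esub> i"
      using maximal_ideal_sum[OF assms(2,3) nI ab(1)] .
    obtain k where k: "k \<in> K" "M #>\<^bsub>add_monoid A\<^esub> b = M #>\<^bsub>add_monoid A\<^esub> k"
      using maximal_ideal_sum[OF assms(2,4) nK ab(2)] .
    have c: "i \<in> carrier A" "k \<in> carrier A"
      using i k assms brace_ideal_carrier_subset by blast+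
    have "brace_star A i k \<in> M" using brace_star_mem_Int assms(3-5) i k by blast
    then show ?thesis
      using brace_star_cong_ideal[OF M ab(1) c(1) ab(2) c(2) i(2) k(2)] ab c
        coset_eq_zero_coset_iff[OF M brace_star_closed] by metis
  qed
  \<comment> \<open>\<open>M\<close> is an additive subgroup containing all generators.\<close>
  then have "brace_square A \<subseteq> M"
    unfolding brace_square_def
    by (intro add.generate_subgroup_incl normal_imp_subgroup brace_idealD M) auto
  then show False
    using assms(1,2) brace_ideal_carrier_subset[OF M]
    by (metis maximal_ideal_def perfect_brace_def subset_antisym)
qed

text \<open>Intersecting with the carrier covers empty \<open>F\<close>, whose intersection is the
  whole type.\<close>

lemma brace_ideal_Inter:
  assumes "finite F" "\<And>I. I \<in> F \<Longrightarrow> brace_ideal I A"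
  shows "brace_ideal (carrier A \<inter> \<Inter>F) A"
  using assms
proof (induction F rule: finite_induct)
  case (insert M F)
  have "carrier A \<inter> \<Inter>(insert M F) = M \<inter> (carrier A \<inter> \<Inter>F)" by auto
  then show ?case using insert brace_ideal_Int by auto
qed (simp add: brace_ideal_carrier)

text \<open>Primality is applied one member at a time: N \<subseteq> M forces equality as
  \<open>N\<close> is maximal and \<open>M\<close> proper, and the empty family would put the whole
  carrier inside \<open>M\<close>.\<close>

lemma maximal_ideal_prime_Inter:
  assumes "perfect_brace A" "maximal_ideal M" "finite F"
    and "\<And>N. N \<in> F \<Longrightarrow> maximal_ideal N" "carrier A \<inter> \<Inter>F \<subseteq> M"
  shows "M \<in> F"
  using assms(3-5)
proof (induction F rule: finite_induct)
  case empty
  then show ?case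
    using assms(2) brace_ideal_carrier_subset by (fastforce simp: maximal_ideal_def)
next
  case (insert N F)
  have "brace_ideal N A" "brace_ideal (carrier A \<inter> \<Inter>F) A"
    using insert by (auto simp: maximal_ideal_def intro!: brace_ideal_Inter)
  moreover have "N \<inter> (carrier A \<inter> \<Inter>F) \<subseteq> M" using insert.prems by auto
  ultimately have "N \<subseteq> M \<or> carrier A \<inter> \<Inter>F \<subseteq> M"
    using maximal_ideal_prime[OF assms(1,2)] by blast
  moreover have "N \<subseteq> M \<Longrightarrow> M = N"
    using insert.prems(1)[of N] assms(2) unfolding maximal_ideal_def by auto
  ultimately show ?case using insert by blast
qed

lemma finite_maximal_ideals:
  assumes "perfect_brace A" "artinian_brace A"
  shows "finite {M. maximal_ideal M}"
proof (rule ccontr)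
  assume "infinite {M. maximal_ideal M}"
  then obtain f :: "nat \<Rightarrow> 'a set" where f: "inj f" "range f \<subseteq> {M. maximal_ideal M}"
    using infinite_countable_subset by blast
  have fm: "maximal_ideal (f n)" for n using f(2) by auto
  define I where "I n = carrier A \<inter> \<Inter>(f ` {..<n})" for n
  have "\<forall>n. brace_ideal (I n) A"
    using fm unfolding I_def by (auto simp: maximal_ideal_def intro!: brace_ideal_Inter)
  moreover have "\<forall>n. I (Suc n) \<subseteq> I n" by (auto simp: I_def)
  ultimately obtain N where "\<forall>n\<ge>N. I n = I N"
    using assms(2) unfolding artinian_brace_def by blast
  \<comment> \<open>Stationarity means that \<open>f N\<close> contains the intersection of its
    predecessors, so it is one of them, against injectivity.\<close>
  then have "I N = I (Suc N)" by (metis le_SucI order_refl)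
  then have "I N \<subseteq> f N" by (auto simp: I_def)
  then have "f N \<in> f ` {..<N}"
    using maximal_ideal_prime_Inter[OF assms(1) fm, of "f ` {..<N}"] fm
    by (auto simp: I_def)
  then show False using f(1) by (auto dest: injD)
qed

text \<open>If the \<open>x\<close> found for \<open>F\<close> lies in the new \<open>M\<close>, it
  is shifted by some \<open>y\<close> in every member of \<open>F\<close> but outside
  \<open>M\<close>. The shift leaves the cosets modulo members of \<open>F\<close> unchanged and
  moves \<open>x\<close> out of \<open>M\<close>; such a \<open>y\<close> exists by primality, as M
  \<notin> F.\<close>

lemma ex_avoiding_maximal_ideals:
  assumes "perfect_brace A" "finite F" "\<And>M. M \<in> F \<Longrightarrow> maximal_ideal M"
  shows "\<exists>x\<in>carrier A. \<forall>M\<in>F. x \<notin> M"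
  using assms(2,3)
proof (induction F rule: finite_induct)
  case (insert M F)
  then obtain x where x: "x \<in> carrier A" "\<forall>N\<in>F. x \<notin> N" by auto
  show ?case
  proof (cases "x \<in> M")
    case True
    obtain y where y: "y \<in> carrier A" "\<forall>N\<in>F. y \<in> N" "y \<notin> M"
      using maximal_ideal_prime_Inter[OF assms(1), of M F] insert by blast
    have ideal: "brace_ideal N A" if "N \<in> insert M F" for N
      using insert.prems that by (simp add: maximal_ideal_def)
    have "x \<oplus> y \<notin> N" if "N \<in> F" for N
      using add_mem_ideal_iff[of N y x] ideal that x y by auto
    moreover have "x \<oplus> y \<notin> M"
    proof
      assume "x \<oplus> y \<in> M"
      then have "\<ominus> x \<oplus> (x \<oplus> y) \<in> M"
        using add_mem_ideal neg_mem_ideal ideal True by blast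
      then show False using x y by (simp add: add.m_assoc[symmetric])
    qed
    ultimately show ?thesis using x y by (intro bexI[of _ "x \<oplus> y"]) auto
  qed (use x in auto)
qed auto

lemma brace_ideal_chain_Union:
  assumes "\<C> \<noteq> {}" "subset.chain {I. brace_ideal I A} \<C>"
  shows "brace_ideal (\<Union>\<C>) A"
proof -
  have "subset.chain {I. I \<lhd> add_monoid A} \<C>" "subset.chain {I. I \<lhd> A} \<C>"
    using assms(2) by (auto simp: subset_chain_def brace_ideal_def)
  then have "\<Union>\<C> \<lhd> add_monoid A" "\<Union>\<C> \<lhd> A"
    using add.normal_chain_Union circ.normal_chain_Union assms(1) by auto
  moreover have "\<And>I. I \<in> \<C> \<Longrightarrow> brace_ideal I A"
    using assms(2) by (auto simp: subset_chain_def)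
  ultimately show ?thesis
    unfolding brace_ideal_def by blast
qed

text \<open>Zorn's lemma on the proper ideals above \<open>I\<close>. Finite weight keeps unions of
  chains proper: a finite generating set inside the union already lies in one member, which would
  then be the whole brace.\<close>

lemma ex_maximal_ideal:
  assumes "finite_weight A" "brace_ideal I A" "I \<noteq> carrier A"
  obtains M where "maximal_ideal M" "I \<subseteq> M"
proof -
  obtain S where S: "finite S" "S \<subseteq> carrier A" "generated_ideal A S = carrier A"
    using assms(1) by (auto simp: finite_weight_def generates_as_ideal_def)
  let ?P = "{J. brace_ideal J A \<and> I \<subseteq> J \<and> J \<noteq> carrier A}"
  have "\<exists>M\<in>?P. \<forall>X\<in>?P. M \<subseteq> X \<longrightarrow> X = M"
  proof (rule subset_Zorn_nonempty)
    show "?P \<noteq> {}" using assms by auto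
    fix \<C> assume ne: "\<C> \<noteq> {}" and ch: "subset.chain ?P \<C>"
    have "subset.chain {J. brace_ideal J A} \<C>" using ch by (auto simp: subset_chain_def)
    then have U: "brace_ideal (\<Union>\<C>) A" using brace_ideal_chain_Union ne by blast
    have "\<Union>\<C> \<noteq> carrier A"
    proof
      assume "\<Union>\<C> = carrier A"
      then obtain J where J: "J \<in> \<C>" "S \<subseteq> J"
        using finite_subset_Union_chain[OF S(1) _ ne ch] S(2) by auto
      then have J': "brace_ideal J A" "J \<noteq> carrier A" using ch by (auto simp: subset_chain_def)
      then have "generated_ideal A S \<subseteq> J" using J by (auto simp: generated_ideal_def)
      then show False using S J' brace_ideal_carrier_subset by blast
    qed
    moreover have "I \<subseteq> \<Union>\<C>" using ne ch unfolding subset_chain_def by blast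
    ultimately show "\<Union>\<C> \<in> ?P" using U by simp
  qed
  then obtain M where M: "M \<in> ?P" "\<forall>X\<in>?P. M \<subseteq> X \<longrightarrow> X = M" by blast
  then have "maximal_ideal M" unfolding maximal_ideal_def by blast
  then show ?thesis using that M by blast
qed

end

theorem theorem4p4:
  fixes A :: "('a, 'b) ring_scheme"
  assumes "skew_left_brace A"
    and "artinian_brace A"
    and "finite_weight A"
    and "perfect_brace A"
  shows "weight A = 1"
proof (cases "carrier A = {\<zero>\<^bsub>A\<^esub>}")
  case nonzero: False
  interpret skew_left_brace A by fact
  obtain x where x: "x \<in> carrier A" "\<And>M. maximal_ideal M \<Longrightarrow> x \<notin> M"
    using ex_avoiding_maximal_ideals[OF assms(4) finite_maximal_ideals] assms by auto
  \<comment> \<open>A proper ideal containing \<open>x\<close> would lie in a maximal one, which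
    \<open>x\<close> avoids.\<close>
  have "I = carrier A" if "brace_ideal I A" "x \<in> I" for I
    using ex_maximal_ideal[OF assms(3) that(1)] x(2) that(2) by blast
  then have "generated_ideal A {x} = carrier A"
    using brace_ideal_carrier x(1) unfolding generated_ideal_def by blast
  then have gen: "generates_as_ideal {x} A"
    using x(1) by (simp add: generates_as_ideal_def)
  \<comment> \<open>The zero ideal contains the empty set and is proper here; this excludes weight
    0.\<close>
  have "\<not> generates_as_ideal {} A"
    using nonzero brace_ideal_zero
    by (auto simp: generates_as_ideal_def generated_ideal_def)
  then have "1 \<le> enat (card S)" if "finite S" "generates_as_ideal S A" for S
    using that by (cases "S = {}") (auto simp: one_enat_def Suc_le_eq card_gt_0_iff)
  then have "1 \<le> weight A"
    using nonzero by (auto simp: weight_def intro!: INF_greatest)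
  moreover have "weight A \<le> enat (card {x})"
    using nonzero gen by (auto simp: weight_def intro!: INF_lower2[of "{x}"] simp: one_enat_def)
  ultimately show ?thesis by (simp add: one_enat_def)
qed (simp add: weight_def)

end
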